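(* Let $d\ge2$, let $\mathbf X_1,\dots,\mathbf X_n$ be i.i.d. random vectors in $\mathbb R^d$ with continuous marginal distribution functions, let $\mathbf N\in\mathbb N^d$, and let $\widehat c^{[\mathbf N]}$ be the $\mathbf N$-th order copula density estimator. Then: (i) $\int_{[0,1]^d}\widehat c^{[\mathbf N]}(\mathbf u)\,d\mathbf u=1$; (ii) for every $j\in\{1,\dots,d\}$ and every $u_j\in[0,1]$, writing $\mathbf x_{-j}=(x_1,\dots,x_{j-1},u_j,x_{j+1},\dots,x_d)$, $$\int_{[0,1]^{d-1}}\widehat c^{[\mathbf N]}(\mathbf x_{-j})\,dx_1\cdots dx_{j-1}\,dx_{j+1}\cdots dx_d=1;$$ (iii) $\widehat c^{[\mathbf 0]}(\mathbf u)=1$ for all $\mathbf u\in[0,1]^d$.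
   Context: $\mathbb N=\{0,1,2,\dots\}$. $Q_m(x)=\sqrt{2m+1}\,L_m(2x-1)$, $x\in[0,1]$, are the orthonormal shifted Legendre polynomials, where $L_0=1$, $L_1(x)=x$, $(m+1)L_{m+1}(x)=(2m+1)xL_m(x)-mL_{m-1}(x)$. Write $\mathbf X_i=(X_{i1},\dots,X_{id})^T$ and $\widehat F_j(x)=\frac1n\sum_{i=1}^n\mathbf 1(X_{ij}\le x)$. For $\mathbf m\in\mathbb N^d$ set $\widehat\rho_{\mathbf m}=1$ if $\mathbf m=\mathbf 0$; $\widehat\rho_{\mathbf m}=0$ if exactly $d-1$ components of $\mathbf m$ are zero; and $\widehat\rho_{\mathbf m}=\frac1n\sum_{i=1}^n\prod_{j=1}^dQ_{m_j}(\widehat F_j(X_{ij}))$ otherwise. The inequality $\mathbf m\le\mathbf N$ means $m_j\le N_j$ for all $j$. The copula density estimator is $\widehat c^{[\mathbf N]}(u_1,\dots,u_d)=\sum_{\mathbf m\le\mathbf N}\widehat\rho_{\mathbf m}\prod_{j=1}^dQ_{m_j}(u_j)$. *)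

theory Defs
  imports "HOL-Probability.Probability" "HOL-Computational_Algebra.Polynomial"
begin

text \<open>
  Vectors of length \<open>d\<close> are functions on the index set \<open>{1..d}\<close>. In particular \<open>\<real>\<^sup>d\<close> with its
  Borel sets is the product space \<open>\<Pi>\<^sub>M j\<in>{1..d}. borel\<close>, Lebesgue measure on it is
  \<open>\<Pi>\<^sub>M j\<in>{1..d}. lborel\<close>, and for \<open>\<real>\<^sup>d\<^sup>-\<^sup>1\<close> with the \<open>j\<close>-th coordinate left out the index set is
  \<open>{1..d} - {j}\<close>.
\<close>

fun legendre_poly :: "nat \<Rightarrow> real poly" where
  "legendre_poly 0 = 1"
| "legendre_poly (Suc 0) = [:0, 1:]"
| "legendre_poly (Suc (Suc m)) =
     smult (1 / real (m + 2))
       (smult (real (2 * m + 3)) ([:0, 1:] * legendre_poly (Suc m))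
        - smult (real (m + 1)) (legendre_poly m))"

definition shifted_legendre :: "nat \<Rightarrow> real \<Rightarrow> real" where
  "shifted_legendre m x = sqrt (2 * real m + 1) * poly (legendre_poly m) (2 * x - 1)"

text \<open>
  A sample of size \<open>n\<close> is a function \<open>x\<close>, where \<open>x i j\<close> is the \<open>j\<close>-th coordinate of
  the \<open>i\<close>-th observation for \<open>i \<in> {1..n}\<close>.
\<close>

definition empirical_marginal :: "nat \<Rightarrow> (nat \<Rightarrow> nat \<Rightarrow> real) \<Rightarrow> nat \<Rightarrow> real \<Rightarrow> real" where
  "empirical_marginal n x j t = 1 / real n * (\<Sum>i=1..n. indicator {..t} (x i j))"

definition rho_hat :: "nat \<Rightarrow> nat \<Rightarrow> (nat \<Rightarrow> nat \<Rightarrow> real) \<Rightarrow> (nat \<Rightarrow> nat) \<Rightarrow> real" where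
  "rho_hat d n x m =
     (if \<forall>j\<in>{1..d}. m j = 0 then 1
      else if card {j\<in>{1..d}. m j = 0} = d - 1 then 0
      else 1 / real n * (\<Sum>i=1..n. \<Prod>j=1..d.
             shifted_legendre (m j) (empirical_marginal n x j (x i j))))"

text \<open>
  The multi-indices \<open>m \<le> N\<close> are taken to be extensional functions, so that each of
  them is counted exactly once.
\<close>

definition copula_density_estimator ::
    "nat \<Rightarrow> nat \<Rightarrow> (nat \<Rightarrow> nat \<Rightarrow> real) \<Rightarrow> (nat \<Rightarrow> nat) \<Rightarrow> (nat \<Rightarrow> real) \<Rightarrow> real" where
  "copula_density_estimator d n x N u =
     (\<Sum>m \<in> (\<Pi>\<^sub>E j\<in>{1..d}. {..N j}).
        rho_hat d n x m * (\<Prod>j=1..d. shifted_legendre (m j) (u j)))"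

end

theory Submission
  imports Defs
begin

text \<open>
  For \<open>m \<ge> 1\<close> the polynomial \<open>(2m + 1) L\<^sub>m\<close> is the derivative of \<open>L\<^sub>m\<^sub>+\<^sub>1 - L\<^sub>m\<^sub>-\<^sub>1\<close>, which vanishes
  at \<open>\<plusminus>1\<close>; hence \<open>Q\<^sub>m\<close> integrates to \<open>0\<close> over the unit interval. By Fubini, integrating over the
  whole cube leaves only the coefficient of \<open>m = 0\<close>, which is \<open>1\<close>. Integrating out all
  coordinates but the \<open>j\<close>-th leaves only indices \<open>m\<close> that vanish off \<open>j\<close>, and for those that
  are not \<open>0\<close> the coefficient is \<open>0\<close> by definition.
\<close>

section \<open>Recurrence and derivative identities for Legendre polynomials\<close>

lemma legendre_poly_rec:
  "real (m + 2) * poly (legendre_poly (m + 2)) x =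
     real (2 * m + 3) * x * poly (legendre_poly (m + 1)) x - real (m + 1) * poly (legendre_poly m) x"
  by (simp add: field_simps del: of_nat_add of_nat_Suc)

lemma poly_pderiv_legendre_poly_rec:
  "real (m + 2) * poly (pderiv (legendre_poly (m + 2))) x =
     real (2 * m + 3) * (poly (legendre_poly (m + 1)) x + x * poly (pderiv (legendre_poly (m + 1))) x)
     - real (m + 1) * poly (pderiv (legendre_poly m)) x"
  by (simp add: pderiv_smult pderiv_diff pderiv_mult pderiv_pCons field_simps
      del: of_nat_add of_nat_Suc)

text \<open>The two classical mixed identities support each other in a simultaneous induction: the
  three-term recurrence and its derivative carry the pair from \<open>m\<close> to
  \<open>m + 1\<close>.\<close>

lemma legendre_poly_deriv_mixed:
  shows "x * poly (pderiv (legendre_poly (m + 1))) x - poly (pderiv (legendre_poly m)) x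
           = real (m + 1) * poly (legendre_poly (m + 1)) x"
    and "poly (pderiv (legendre_poly (m + 1))) x - x * poly (pderiv (legendre_poly m)) x
           = real (m + 1) * poly (legendre_poly m) x"
proof (induction m)
  case 0
  {
    case 1
    show ?case by (simp add: pderiv_pCons)
  next
    case 2
    show ?case by (simp add: pderiv_pCons)
  }
next
  case (Suc m)
  define k where "k = real m"
  define a where "a = poly (legendre_poly m) x"
  define b where "b = poly (legendre_poly (m + 1)) x"
  define c where "c = poly (legendre_poly (m + 2)) x"
  define a' where "a' = poly (pderiv (legendre_poly m)) x"
  define b' where "b' = poly (pderiv (legendre_poly (m + 1))) x"
  define c' where "c' = poly (pderiv (legendre_poly (m + 2))) x"
  have B: "x * b' - a' = (k + 1) * b" and C: "b' - x * a' = (k + 1) * a"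
    using Suc.IH unfolding a_def b_def a'_def b'_def k_def by simp_all
  have R: "(k + 2) * c = (2 * k + 3) * x * b - (k + 1) * a"
    using legendre_poly_rec[of m x] unfolding a_def b_def c_def k_def by (simp add: algebra_simps del: legendre_poly.simps)
  have R': "(k + 2) * c' = (2 * k + 3) * (b + x * b') - (k + 1) * a'"
    using poly_pderiv_legendre_poly_rec[of m x] unfolding a'_def b_def b'_def c'_def k_def
    by (simp add: algebra_simps del: legendre_poly.simps)
  \<comment> \<open>Eliminating \<open>a'\<close> from \<open>R'\<close> by means of
    \<open>B\<close> leaves the coefficient \<open>(2 * k + 3) + (k + 1)^2 = (k + 2)^2\<close> in
    front of \<open>b\<close>.\<close>
  have "(k + 2) * (c' - x * b') = (k + 2) * ((k + 2) * b)"
    using R' B by algebra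
  moreover have "k + 2 \<noteq> 0"
    by (simp add: k_def add_nonneg_eq_0_iff)
  ultimately have C': "c' - x * b' = (k + 2) * b"
    by simp
  \<comment> \<open>\<open>C'\<close> turns the left side into
    \<open>(x^2 - 1) * b' + (k + 2) * x * b\<close>. By \<open>B\<close> and \<open>C\<close>,
    \<open>(x^2 - 1) * b' = (k + 1) * (x * b - a)\<close>, and \<open>R\<close> recognises the sum
    as \<open>(k + 2) * c\<close>.\<close>
  have B': "x * c' - b' = (k + 2) * c"
    using C' B C R by algebra
  {
    case 1
    show ?case
      using B' unfolding b'_def c_def c'_def k_def by (simp add: algebra_simps del: legendre_poly.simps)
  next
    case 2
    show ?case
      using C' unfolding b_def b'_def c'_def k_def by (simp add: algebra_simps del: legendre_poly.simps)
  }
qed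

text \<open>Both mixed identities, the first at \<open>m\<close> and the second at
  \<open>m + 1\<close>, contain \<open>x\<close> times the derivative of
  \<open>legendre_poly (m + 1)\<close>; this term cancels in the difference.\<close>

lemma poly_pderiv_legendre_poly_diff:
  "poly (pderiv (legendre_poly (m + 2) - legendre_poly m)) x
     = real (2 * m + 3) * poly (legendre_poly (m + 1)) x"
  using legendre_poly_deriv_mixed(1)[of x m] legendre_poly_deriv_mixed(2)[of "m + 1" x]
  by (simp add: pderiv_diff algebra_simps del: legendre_poly.simps)

lemma poly_legendre_poly_1: "poly (legendre_poly m) 1 = 1"
  by (induction m rule: legendre_poly.induct) (simp_all add: field_simps)

lemma poly_legendre_poly_minus_1: "poly (legendre_poly m) (- 1) = (- 1) ^ m"
  by (induction m rule: legendre_poly.induct) (simp_all add: field_simps)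

section \<open>Shifted Legendre polynomials on the unit interval\<close>

lemma shifted_legendre_0 [simp]: "shifted_legendre 0 x = 1"
  by (simp add: shifted_legendre_def)

lemma continuous_on_shifted_legendre: "continuous_on A (shifted_legendre m)"
  unfolding shifted_legendre_def by (intro continuous_intros)

lemma set_integrable_shifted_legendre:
  "set_integrable lborel {0..1} (shifted_legendre m)"
  unfolding set_integrable_def by (intro borel_integrable_compact continuous_on_shifted_legendre) auto

lemma set_integral_shifted_legendre:
  "(LINT x : {0..1} | lborel. shifted_legendre m x) = (if m = 0 then 1 else 0)"
proof (cases m)
  case 0
  then show ?thesis
    by (simp add: set_lebesgue_integral_def)
next
  case (Suc k)
  define p where "p = legendre_poly (k + 2) - legendre_poly k"
  \<comment> \<open>An antiderivative of \<open>shifted_legendre m\<close> for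
    \<open>m = k + 1\<close>: the denominator cancels \<open>2 * k + 3\<close> from the derivative
    of \<open>p\<close> and the 2 from the inner function \<open>2 * x - 1\<close>.\<close>
  define F where "F = (\<lambda>x. sqrt (2 * real m + 1) / (2 * real (2 * k + 3)) * poly p (2 * x - 1))"
  have "(F has_real_derivative shifted_legendre m x) (at x within {0..1})" for x
  proof -
    have "(F has_real_derivative
        sqrt (2 * real m + 1) / (2 * real (2 * k + 3)) * (poly (pderiv p) (2 * x - 1) * 2))
        (at x within {0..1})"
      unfolding F_def
      by (rule DERIV_cmult, rule DERIV_chain2[OF poly_DERIV]) (auto intro!: derivative_eq_intros)
    also have "sqrt (2 * real m + 1) / (2 * real (2 * k + 3)) * (poly (pderiv p) (2 * x - 1) * 2)
        = shifted_legendre m x"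
      using Suc unfolding p_def shifted_legendre_def poly_pderiv_legendre_poly_diff
      by (simp add: field_simps del: legendre_poly.simps)
    finally show ?thesis .
  qed
  then have "(\<integral>x. indicator {0..1} x *\<^sub>R shifted_legendre m x \<partial>lborel) = F 1 - F 0"
    by (intro integral_FTC_Icc continuous_on_shifted_legendre)
       (simp_all add: has_real_derivative_iff_has_vector_derivative)
  \<comment> \<open>The endpoints 0 and 1 correspond to -1 and 1, where \<open>p\<close> vanishes
    because \<open>k + 2\<close> and \<open>k\<close> have the same parity.\<close>
  also have "\<dots> = 0"
    by (simp add: F_def p_def poly_legendre_poly_1 poly_legendre_poly_minus_1
        del: legendre_poly.simps)
  finally show ?thesis
    using Suc by (simp add: set_lebesgue_integral_def)
qed

section \<open>Integrals of products over boxes\<close>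

text \<open>Absorbing the indicator of the box into the factors reduces set integrals to plain
  integrals of products of one-variable functions. Extensionality of \<open>u\<close> is part of
  membership in the box and holds on the space of \<open>PiM I M\<close>.\<close>

lemma indicator_PiE_mult_prod:
  fixes f :: "'i \<Rightarrow> 'a \<Rightarrow> real"
  assumes "finite I" "u \<in> extensional I"
  shows "indicator (\<Pi>\<^sub>E k\<in>I. A k) u *\<^sub>R (\<Prod>k\<in>I. f k (u k)) = (\<Prod>k\<in>I. indicator (A k) (u k) *\<^sub>R f k (u k))"
proof -
  have "(indicator (\<Pi>\<^sub>E k\<in>I. A k) u :: real) = (\<Prod>k\<in>I. indicator (A k) (u k))"
    using assms by (auto simp: indicator_def PiE_def Pi_def intro!: prod.neutral[symmetric])
  then show ?thesis
    by (simp add: prod.distrib)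
qed

context product_sigma_finite
begin

lemma set_integrable_prod_PiE:
  fixes f :: "'i \<Rightarrow> 'a \<Rightarrow> real"
  assumes "finite I" "\<And>k. k \<in> I \<Longrightarrow> set_integrable (M k) (A k) (f k)"
  shows "set_integrable (PiM I M) (\<Pi>\<^sub>E k\<in>I. A k) (\<lambda>u. \<Prod>k\<in>I. f k (u k))"
proof -
  have *: "indicator (\<Pi>\<^sub>E k\<in>I. A k) u *\<^sub>R (\<Prod>k\<in>I. f k (u k)) = (\<Prod>k\<in>I. indicator (A k) (u k) *\<^sub>R f k (u k))"
    if "u \<in> space (PiM I M)" for u
    using that assms(1) by (intro indicator_PiE_mult_prod) (auto simp: space_PiM PiE_def)
  have "integrable (PiM I M) (\<lambda>u. \<Prod>k\<in>I. indicator (A k) (u k) *\<^sub>R f k (u k))"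
    using assms by (intro product_integrable_prod) (auto simp: set_integrable_def)
  then show ?thesis
    unfolding set_integrable_def
    using Bochner_Integration.integrable_cong[OF refl *, of "PiM I M" "\<lambda>u. u"] by simp
qed

lemma set_integral_prod_PiE:
  fixes f :: "'i \<Rightarrow> 'a \<Rightarrow> real"
  assumes "finite I" "\<And>k. k \<in> I \<Longrightarrow> set_integrable (M k) (A k) (f k)"
  shows "(LINT u : (\<Pi>\<^sub>E k\<in>I. A k) | PiM I M. \<Prod>k\<in>I. f k (u k)) = (\<Prod>k\<in>I. LINT x : A k | M k. f k x)"
proof -
  have "(LINT u : (\<Pi>\<^sub>E k\<in>I. A k) | PiM I M. \<Prod>k\<in>I. f k (u k))
      = (\<integral>u. (\<Prod>k\<in>I. indicator (A k) (u k) *\<^sub>R f k (u k)) \<partial>PiM I M)"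
    unfolding set_lebesgue_integral_def using assms(1)
    by (intro Bochner_Integration.integral_cong indicator_PiE_mult_prod)
       (auto simp: space_PiM PiE_def)
  also have "\<dots> = (\<Prod>k\<in>I. LINT x : A k | M k. f k x)"
    unfolding set_lebesgue_integral_def using assms
    by (intro product_integral_prod) (auto simp: set_integrable_def)
  finally show ?thesis .
qed

end

interpretation lborel_product: product_sigma_finite "\<lambda>_ :: 'i. lborel :: real measure"
  by standard

lemma set_integrable_prod_shifted_legendre:
  assumes "finite I"
  shows "set_integrable (\<Pi>\<^sub>M k\<in>I. lborel) (\<Pi>\<^sub>E k\<in>I. {0..1})
    (\<lambda>u. \<Prod>k\<in>I. shifted_legendre (m k) (u k))"
  using assms by (intro lborel_product.set_integrable_prod_PiE set_integrable_shifted_legendre)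

lemma set_integral_prod_shifted_legendre:
  assumes "finite I"
  shows "(LINT u : (\<Pi>\<^sub>E k\<in>I. {0..1}) | (\<Pi>\<^sub>M k\<in>I. lborel). \<Prod>k\<in>I. shifted_legendre (m k) (u k))
    = (if \<forall>k\<in>I. m k = 0 then 1 else 0)"
  using assms
  by (subst lborel_product.set_integral_prod_PiE)
     (auto simp: set_integral_shifted_legendre set_integrable_shifted_legendre)

text \<open>The multi-indices in \<open>S\<close> may live on a larger set than \<open>I\<close>.
  This lets one formula serve both the full cube and the cube with one coordinate left out.\<close>

lemma set_integral_sum_prod_shifted_legendre:
  assumes "finite I" "finite S"
  shows "(LINT u : (\<Pi>\<^sub>E k\<in>I. {0..1}) | (\<Pi>\<^sub>M k\<in>I. lborel).
      \<Sum>m\<in>S. c m * (\<Prod>k\<in>I. shifted_legendre (m k) (u k)))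
    = (\<Sum>m\<in>S. c m * (if \<forall>k\<in>I. m k = 0 then 1 else 0))"
proof -
  have "(LINT u : (\<Pi>\<^sub>E k\<in>I. {0..1}) | (\<Pi>\<^sub>M k\<in>I. lborel).
      \<Sum>m\<in>S. c m * (\<Prod>k\<in>I. shifted_legendre (m k) (u k)))
    = (\<Sum>m\<in>S. LINT u : (\<Pi>\<^sub>E k\<in>I. {0..1}) | (\<Pi>\<^sub>M k\<in>I. lborel).
      c m * (\<Prod>k\<in>I. shifted_legendre (m k) (u k)))"
    unfolding set_lebesgue_integral_def scaleR_sum_right
    using set_integrable_mult_right[OF set_integrable_prod_shifted_legendre[OF assms(1)]]
    by (intro Bochner_Integration.integral_sum) (simp add: set_integrable_def)
  then show ?thesis
    by (simp add: set_integral_prod_shifted_legendre[OF assms(1)])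
qed

section \<open>The zero multi-index and the coefficients\<close>

lemma sum_PiE_eq_at_zero:
  fixes g :: "('i \<Rightarrow> nat) \<Rightarrow> real"
  assumes "finite I" "\<And>m. m \<in> (\<Pi>\<^sub>E k\<in>I. {..N k}) \<Longrightarrow> \<exists>k\<in>I. m k \<noteq> 0 \<Longrightarrow> g m = 0"
  shows "(\<Sum>m\<in>(\<Pi>\<^sub>E k\<in>I. {..N k}). g m) = g (\<lambda>k\<in>I. 0)"
proof -
  have "g m = 0" if "m \<in> (\<Pi>\<^sub>E k\<in>I. {..N k}) - {\<lambda>k\<in>I. 0}" for m
  proof -
    have "\<exists>k\<in>I. m k \<noteq> 0"
    proof (rule ccontr)
      assume "\<not> (\<exists>k\<in>I. m k \<noteq> 0)"
      \<comment> \<open>Extensionality fixes the values off \<open>I\<close>, so only one index in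
        the range of summation vanishes on \<open>I\<close>.\<close>
      with that have "m = (\<lambda>k\<in>I. 0)"
        by (intro extensionalityI[of m I]) (auto simp: PiE_def)
      with that show False
        by simp
    qed
    with that assms(2) show ?thesis
      by simp
  qed
  with \<open>finite I\<close> have "(\<Sum>m\<in>(\<Pi>\<^sub>E k\<in>I. {..N k}). g m) = (\<Sum>m\<in>{\<lambda>k\<in>I. 0}. g m)"
    by (intro sum.mono_neutral_right finite_PiE) auto
  then show ?thesis
    by simp
qed

lemma rho_hat_eq_1:
  assumes "\<forall>j\<in>{1..d}. m j = 0"
  shows "rho_hat d n x m = 1"
  using assms by (simp add: rho_hat_def)

lemma rho_hat_eq_0:
  assumes "j \<in> {1..d}" "m j \<noteq> 0" "\<forall>k\<in>{1..d} - {j}. m k = 0"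
  shows "rho_hat d n x m = 0"
proof -
  have "{k \<in> {1..d}. m k = 0} = {1..d} - {j}"
    using assms by auto
  then have "card {k \<in> {1..d}. m k = 0} = d - 1"
    using assms(1) by simp
  with assms show ?thesis
    by (auto simp: rho_hat_def)
qed

section \<open>The three properties of the estimator\<close>

lemma integral_copula_density_estimator:
  "(LINT u : (\<Pi>\<^sub>E k\<in>{1..d}. {0..1}) | (\<Pi>\<^sub>M k\<in>{1..d}. lborel).
      copula_density_estimator d n x N u) = 1"
proof -
  have "(LINT u : (\<Pi>\<^sub>E k\<in>{1..d}. {0..1}) | (\<Pi>\<^sub>M k\<in>{1..d}. lborel).
      copula_density_estimator d n x N u)
    = (\<Sum>m\<in>(\<Pi>\<^sub>E k\<in>{1..d}. {..N k}). rho_hat d n x m * (if \<forall>k\<in>{1..d}. m k = 0 then 1 else 0))"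
    unfolding copula_density_estimator_def
    by (intro set_integral_sum_prod_shifted_legendre finite_PiE) auto
  also have "\<dots> = 1"
    by (subst sum_PiE_eq_at_zero) (auto simp: rho_hat_eq_1)
  finally show ?thesis .
qed

lemma marginal_copula_density_estimator:
  assumes j: "j \<in> {1..d}"
  shows "(LINT y : (\<Pi>\<^sub>E k\<in>{1..d} - {j}. {0..1}) | (\<Pi>\<^sub>M k\<in>{1..d} - {j}. lborel).
      copula_density_estimator d n x N (y(j := t))) = 1"
proof -
  have "copula_density_estimator d n x N (y(j := t))
    = (\<Sum>m\<in>(\<Pi>\<^sub>E k\<in>{1..d}. {..N k}). (rho_hat d n x m * shifted_legendre (m j) t) *
        (\<Prod>k\<in>{1..d} - {j}. shifted_legendre (m k) (y k)))" for y
    \<comment> \<open>The factor at \<open>j\<close> depends on \<open>t\<close> only and joins the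
      coefficient; in the others \<open>y(j := t)\<close> agrees with \<open>y\<close>.\<close>
    unfolding copula_density_estimator_def prod.remove[OF finite_atLeastAtMost j]
    by (simp add: mult.assoc cong: prod.cong_simp)
  then have "(LINT y : (\<Pi>\<^sub>E k\<in>{1..d} - {j}. {0..1}) | (\<Pi>\<^sub>M k\<in>{1..d} - {j}. lborel).
      copula_density_estimator d n x N (y(j := t)))
    = (\<Sum>m\<in>(\<Pi>\<^sub>E k\<in>{1..d}. {..N k}). (rho_hat d n x m * shifted_legendre (m j) t) *
        (if \<forall>k\<in>{1..d} - {j}. m k = 0 then 1 else 0))"
    by (simp only:) (intro set_integral_sum_prod_shifted_legendre finite_PiE, auto)
  also have "\<dots> = 1"
  proof (subst sum_PiE_eq_at_zero)
    fix m :: "nat \<Rightarrow> nat"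
    assume "\<exists>k\<in>{1..d}. m k \<noteq> 0"
    \<comment> \<open>A nonzero index that vanishes off \<open>j\<close> has its only nonzero
      component at \<open>j\<close>, so its coefficient is 0. Any other nonzero index is removed by
      the conditional factor.\<close>
    then have "rho_hat d n x m = 0" if "\<forall>k\<in>{1..d} - {j}. m k = 0"
      using that by (metis DiffI singletonD rho_hat_eq_0[OF j])
    then show "rho_hat d n x m * shifted_legendre (m j) t *
        (if \<forall>k\<in>{1..d} - {j}. m k = 0 then 1 else 0) = 0"
      by simp
  qed (use j in \<open>auto simp: rho_hat_eq_1\<close>)
  finally show ?thesis .
qed

text \<open>Every component ranges over \<open>{..0}\<close>, so the sum consists of the zero index
  alone, with coefficient 1 and all polynomial factors equal to 1.\<close>

lemma copula_density_estimator_order_0: "copula_density_estimator d n x (\<lambda>_. 0) u = 1"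
  unfolding copula_density_estimator_def
  by (subst sum_PiE_eq_at_zero) (auto simp: rho_hat_eq_1)

theorem proposition3:
  fixes M :: "'w measure"
    and X :: "nat \<Rightarrow> 'w \<Rightarrow> nat \<Rightarrow> real"
    and N :: "nat \<Rightarrow> nat"
    and d n :: nat
  assumes "d \<ge> 2"
    and "n \<ge> 1"
    and "prob_space M"
    and indep: "prob_space.indep_vars M (\<lambda>i. \<Pi>\<^sub>M j\<in>{1..d}. (borel :: real measure)) X {1..n}"
    and ident: "\<And>i i'. i \<in> {1..n} \<Longrightarrow> i' \<in> {1..n} \<Longrightarrow>
      distr M (\<Pi>\<^sub>M j\<in>{1..d}. borel) (X i) = distr M (\<Pi>\<^sub>M j\<in>{1..d}. borel) (X i')"
    and cont: "\<And>i j. i \<in> {1..n} \<Longrightarrow> j \<in> {1..d} \<Longrightarrow>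
      continuous_on UNIV (cdf (distr M borel (\<lambda>\<omega>. X i \<omega> j)))"
  shows "\<forall>\<omega>\<in>space M.
      (LINT u : (\<Pi>\<^sub>E k\<in>{1..d}. {0..1}) | (\<Pi>\<^sub>M k\<in>{1..d}. lborel).
         copula_density_estimator d n (\<lambda>i. X i \<omega>) N u) = 1
    \<and> (\<forall>j\<in>{1..d}. \<forall>u\<^sub>j\<in>{0..1::real}.
        (LINT x : (\<Pi>\<^sub>E k\<in>{1..d} - {j}. {0..1}) | (\<Pi>\<^sub>M k\<in>{1..d} - {j}. lborel).
           copula_density_estimator d n (\<lambda>i. X i \<omega>) N (x(j := u\<^sub>j))) = 1)
    \<and> (\<forall>u \<in> (\<Pi>\<^sub>E k\<in>{1..d}. {0..1}).
        copula_density_estimator d n (\<lambda>i. X i \<omega>) (\<lambda>_. 0) u = 1)"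
  by (intro ballI conjI integral_copula_density_estimator marginal_copula_density_estimator
      copula_density_estimator_order_0)

end
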